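(* For every positive integer $n$, $$T(n, \mathbb{N}\setminus\{1\})=\frac{n!}{2^{\lfloor n/2\rfloor}}.$$
   Context: Here $\mathbb{N}=\{1,2,3,\dots\}$ and $[n]=\{1,\dots,n\}$. For $D\subseteq\mathbb{N}$, two permutations $\pi,\sigma$ of $[n]$ are called $G(D)$-different if there is a position $i\in[n]$ with $|\pi(i)-\sigma(i)|\in D$. $T(n,D)$ denotes the maximum cardinality of a set of permutations of $[n]$ any two distinct members of which are $G(D)$-different. (Equivalently, $G(D)$ is the graph on $\mathbb{N}$ with edges $\{i,i+d\}$, $i\in\mathbb{N}$, $d\in D$, and two permutations are $G(D)$-different if they map some $i$ to adjacent vertices.) *)

theory Defs
  imports Complex_Main "HOL-Combinatorics.Permutations"
begin

text \<open>
  A permutation of $[n]$ is a function \<open>\<pi>\<close> with \<open>\<pi> permutes {1..n}\<close>; such a function is the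
  identity outside \<open>{1..n}\<close>, so distinct functions are distinct permutations.
  The difference is taken in \<open>int\<close> because subtraction on \<open>nat\<close> truncates.
\<close>

definition G_different :: "nat set \<Rightarrow> nat \<Rightarrow> (nat \<Rightarrow> nat) \<Rightarrow> (nat \<Rightarrow> nat) \<Rightarrow> bool" where
  "G_different D n \<pi> \<sigma> \<longleftrightarrow> (\<exists>i\<in>{1..n}. \<bar>int (\<pi> i) - int (\<sigma> i)\<bar> \<in> int ` D)"

definition G_different_families :: "nat set \<Rightarrow> nat \<Rightarrow> (nat \<Rightarrow> nat) set set" where
  "G_different_families D n =
     {F. F \<subseteq> {\<pi>. \<pi> permutes {1..n}} \<and> pairwise (G_different D n) F}"

definition T :: "nat \<Rightarrow> nat set \<Rightarrow> nat" where
  "T n D = Max (card ` G_different_families D n)"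

text \<open>The maximum in \<open>T\<close> ranges over a finite nonempty set, hence is attained.\<close>

lemma finite_G_different_families: "finite (G_different_families D n)"
  by (rule finite_subset[of _ "Pow {\<pi>. \<pi> permutes {1..n}}"])
    (auto simp: G_different_families_def finite_permutations)

lemma G_different_families_nonempty: "G_different_families D n \<noteq> {}"
  unfolding G_different_families_def by (auto intro: exI[of _ "{}"])

end

(* Two permutations fail to be G-different iff their values differ by at most 1 everywhere, i.e. iff
   they differ by left multiplication with a product of disjoint transpositions (j j+1).

   Upper bound: the transpositions (1 2), (3 4), ... generate a group of order 2^(n div 2), and two
   members of the same coset of it are never G-different.

   Lower bound: colour a permutation by the orientations (parities of the relative order of the
   positions) of the value triples {2k-1, 2k, 2k+1}. For a nontrivial product of disjoint
   transpositions (j j+1), either the least even j or, if all j are odd, the greatest j gives a triple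
   on which exactly one transposition acts, so its orientation is reversed. Hence each of the at most
   2^(n div 2) colour classes is pairwise G-different, and one of them is large enough. *)

theory Submission
  imports Defs
begin

lemma G_different_iff:
  "G_different ({1..} - {1}) n \<pi> \<sigma> \<longleftrightarrow> (\<exists>i\<in>{1..n}. \<bar>int (\<pi> i) - int (\<sigma> i)\<bar> \<ge> 2)"
proof -
  have "z \<in> int ` ({1..} - {1}) \<longleftrightarrow> z \<ge> 2" for z :: int
  proof
    assume "z \<ge> 2"
    then have "z = int (nat z)" "nat z \<in> {1..} - {1}" by auto
    then show "z \<in> int ` ({1..} - {1})" by blast
  qed auto
  then show ?thesis unfolding G_different_def by simp
qed

section \<open>Upper bound\<close>

text \<open>Block \<open>k\<close> is {2k-1, 2k}, so this is the product of the transpositions (2k-1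
  2k) over \<open>k\<close> in \<open>A\<close>. Block 0 consists of 0 alone, which truncated
  subtraction leaves fixed.\<close>

definition swap_blocks :: "nat set \<Rightarrow> nat \<Rightarrow> nat" where
  "swap_blocks A x = (if (x + 1) div 2 \<in> A then if odd x then x + 1 else x - 1 else x)"

lemma swap_blocks_block:
  assumes "0 \<notin> A"
  shows "(swap_blocks A x + 1) div 2 = (x + 1) div 2"
proof (cases "(x + 1) div 2 \<in> A")
  case True
  with assms have "x \<noteq> 0" by (cases "x = 0") auto
  with True show ?thesis unfolding swap_blocks_def by (simp; presburger)
qed (simp add: swap_blocks_def)

lemma swap_blocks_involution:
  assumes "0 \<notin> A"
  shows "swap_blocks A (swap_blocks A x) = x"
proof (cases "(x + 1) div 2 \<in> A")
  case True
  then have "x \<noteq> 0" using assms by (cases "x = 0") auto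
  with True swap_blocks_block[OF assms, of x] show ?thesis
    by (auto simp: swap_blocks_def)
qed (simp add: swap_blocks_def)

lemma swap_blocks_permutes:
  assumes "A \<subseteq> {1..n div 2}"
  shows "swap_blocks A permutes {1..n}"
proof -
  have "0 \<notin> A" using assms by auto
  then have "bij (swap_blocks A)"
    by (intro involuntory_imp_bij swap_blocks_involution)
  moreover have "swap_blocks A x = x" if "x \<notin> {1..n}" for x
  proof -
    have "(x + 1) div 2 \<notin> A \<or> x = n + 1"
      using that assms by (cases "x = 0") (auto dest!: subsetD)
    then have "(x + 1) div 2 \<notin> A"
      using assms by (auto dest!: subsetD)
    then show ?thesis by (simp add: swap_blocks_def)
  qed
  ultimately show ?thesis unfolding permutes_def
    by (auto simp: bij_iff)
qed

text \<open>\<open>A\<close> can be read off from the even numbers \<open>2 * k\<close> that are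
  moved. The index 0 leaves no such trace, so it is excluded.\<close>

lemma swap_blocks_inj:
  assumes "0 \<notin> A" "0 \<notin> B" "swap_blocks A = swap_blocks B"
  shows "A = B"
proof -
  have "k \<in> A \<longleftrightarrow> swap_blocks A (2 * k) \<noteq> 2 * k" if "0 \<notin> A" for k and A :: "nat set"
    using that by (cases "k = 0") (auto simp: swap_blocks_def)
  with assms show ?thesis by (metis set_eqI)
qed

lemma card_family_upper:
  assumes "F \<in> G_different_families ({1..} - {1}) n"
  shows "card F * 2 ^ (n div 2) \<le> fact n"
proof -
  let ?S = "{\<pi>. \<pi> permutes {1..n}}" and ?P = "Pow {1..n div 2}"
  have FS: "F \<subseteq> ?S" and pw: "pairwise (G_different ({1..} - {1}) n) F"
    using assms by (auto simp: G_different_families_def)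
  let ?f = "\<lambda>(\<pi>, A). swap_blocks A \<circ> \<pi>"
  have "inj_on ?f (F \<times> ?P)"
  proof (rule inj_onI, clarify)
    fix \<pi> A \<sigma> B
    assume *: "\<pi> \<in> F" "\<sigma> \<in> F" "A \<subseteq> {1..n div 2}" "B \<subseteq> {1..n div 2}"
      and eq: "swap_blocks A \<circ> \<pi> = swap_blocks B \<circ> \<sigma>"
    have 0: "0 \<notin> A" "0 \<notin> B" using * by auto
    \<comment> \<open>Block swaps keep every value in its block, so \<open>\<pi>\<close> and
      \<open>\<sigma>\<close> agree up to blocks of size at most two and hence are not
      G-different.\<close>
    have "(\<pi> i + 1) div 2 = (\<sigma> i + 1) div 2" for i
      using swap_blocks_block[OF 0(1), of "\<pi> i"] swap_blocks_block[OF 0(2), of "\<sigma> i"]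
        fun_cong[OF eq, of i] by simp
    moreover have "\<bar>int a - int b\<bar> < 2" if "(a + 1) div 2 = (b + 1) div 2" for a b
      using that by linarith
    ultimately have "\<bar>int (\<pi> i) - int (\<sigma> i)\<bar> < 2" for i
      by blast
    then have "\<not> G_different ({1..} - {1}) n \<pi> \<sigma>"
      unfolding G_different_iff by (simp add: not_le)
    with pw * have [simp]: "\<sigma> = \<pi>" by (auto simp: pairwise_def)
    have "surj \<pi>" using * FS permutes_surj by blast
    with eq have "swap_blocks A = swap_blocks B"
      by (auto simp: fun_eq_iff) (metis surjD)
    with 0 show "\<pi> = \<sigma> \<and> A = B" by (auto dest: swap_blocks_inj)
  qed
  moreover have "?f ` (F \<times> ?P) \<subseteq> ?S"
  proof clarify
    fix \<pi> A assume "\<pi> \<in> F" "A \<subseteq> {1..n div 2}"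
    with FS show "swap_blocks A \<circ> \<pi> permutes {1..n}"
      by (blast intro: permutes_compose swap_blocks_permutes)
  qed
  ultimately have "card (F \<times> ?P) \<le> card ?S"
    by (intro card_inj_on_le) (auto simp: finite_permutations)
  moreover have "card ?S = fact n" by (rule card_permutations) auto
  ultimately show ?thesis by (simp add: card_cartesian_product card_Pow)
qed

section \<open>Lower bound\<close>

text \<open>If the next lower point also moved down, the induction hypothesis would make the point
  below it move up, onto a value already taken. At the bottom, the fixed point 0 blocks a move
  down.\<close>

lemma near_identity_swap_down:
  fixes \<rho> :: "nat \<Rightarrow> nat"
  assumes inj: "inj \<rho>" and 0: "\<rho> 0 = 0" and near: "\<And>x. \<bar>int (\<rho> x) - int x\<bar> < 2"
    and "\<rho> (Suc x) = x"
  shows "\<rho> x = Suc x"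
  using assms(4)
proof (induction x)
  case 0
  then show ?case using inj \<open>\<rho> 0 = 0\<close> by (metis injD nat.distinct(1))
next
  case (Suc x)
  have "\<rho> (Suc x) \<noteq> Suc x" using Suc.prems injD[OF inj, of "Suc x" "Suc (Suc x)"] by auto
  moreover have "\<rho> (Suc x) \<noteq> x"
    using Suc injD[OF inj, of x "Suc (Suc x)"] by auto
  ultimately show ?case using near[of "Suc x"] by linarith
qed

text \<open>Injectivity alone would allow an endless shift \<open>x\<close> to \<open>Suc x\<close>
  on the positive numbers. Surjectivity excludes this: \<open>inv \<rho>\<close> moves
  \<open>Suc x\<close> down, so the previous lemma applies to it.\<close>

lemma near_identity_swap_up:
  fixes \<rho> :: "nat \<Rightarrow> nat"
  assumes bij: "bij \<rho>" and 0: "\<rho> 0 = 0" and near: "\<And>x. \<bar>int (\<rho> x) - int x\<bar> < 2"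
    and up: "\<rho> x = Suc x"
  shows "\<rho> (Suc x) = x"
proof -
  have *: "\<rho> (inv \<rho> y) = y" "inv \<rho> (\<rho> y) = y" for y
    using bij by (simp_all add: bij_is_surj surj_f_inv_f bij_is_inj)
  have "inv \<rho> x = Suc x"
  proof (rule near_identity_swap_down)
    show "inj (inv \<rho>)" using bij by (simp add: bij_imp_bij_inv bij_is_inj)
    show "inv \<rho> 0 = 0" using *(2)[of 0] 0 by simp
    show "\<bar>int (inv \<rho> y) - int y\<bar> < 2" for y using near[of "inv \<rho> y"] *(1)[of y] by simp
    show "inv \<rho> (Suc x) = x" using *(2)[of x] up by simp
  qed
  then show ?thesis using *(1)[of x] by simp
qed

text \<open>For odd \<open>n\<close> all triples lie in \<open>{1..n}\<close>; for even \<open>n\<close> the last one contains the fixed point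
  \<open>n + 1\<close>.\<close>

definition orientation :: "(nat \<Rightarrow> nat) \<Rightarrow> nat \<Rightarrow> bool" where
  "orientation p k \<longleftrightarrow>
     ((p (2*k - 1) < p (2*k)) \<noteq> (p (2*k) < p (2*k + 1))) \<noteq> (p (2*k - 1) < p (2*k + 1))"

definition colour :: "nat \<Rightarrow> (nat \<Rightarrow> nat) \<Rightarrow> nat set" where
  "colour n \<pi> = {k \<in> {1..n div 2}. orientation (inv \<pi>) k}"

text \<open>To be used with \<open>p = inv \<pi>\<close>, \<open>q = inv \<sigma>\<close> and
  \<open>\<rho> = \<sigma> \<circ> inv \<pi>\<close>.\<close>

lemma near_identity_flips_orientation:
  fixes p q \<rho> :: "nat \<Rightarrow> nat"
  assumes perm: "\<rho> permutes {1..n}" and near: "\<And>x. \<bar>int (\<rho> x) - int x\<bar> < 2"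
    and "\<rho> \<noteq> id" and inj: "inj p" and q: "\<And>x. q (\<rho> x) = p x"
  shows "\<exists>k\<in>{1..n div 2}. orientation q k \<noteq> orientation p k"
proof -
  have bij: "bij \<rho>" using perm by (rule permutes_bij)
  have 0: "\<rho> 0 = 0" using perm by (auto simp: permutes_def)
  have up: "\<rho> (Suc x) = x" if "\<rho> x = Suc x" for x
    using near_identity_swap_up[OF bij 0 near that] .
  have down: "\<rho> x = Suc x" if "\<rho> (Suc x) = x" for x
    using near_identity_swap_down[OF bij_is_inj[OF bij] 0 near that] .
  have range: "1 \<le> x \<and> Suc x \<le> n" if "\<rho> x = Suc x" for x
    using that perm up[OF that] unfolding permutes_def
    by (metis atLeastAtMost_iff n_not_Suc_n)
  have neq: "p x \<noteq> p y" if "x \<noteq> y" for x y using inj that by (auto dest: injD)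
  show ?thesis
  proof (cases "\<exists>j. even j \<and> \<rho> j = Suc j")
    case True
    define j where "j = (LEAST j. even j \<and> \<rho> j = Suc j)"
    have j: "even j" "\<rho> j = Suc j"
      using LeastI_ex[OF True] unfolding j_def by auto
    have min: "\<not> (even i \<and> \<rho> i = Suc i)" if "i < j" for i
      using not_less_Least that unfolding j_def by blast
    obtain l where l: "j = 2 * Suc l"
    proof -
      from \<open>even j\<close> obtain b where b: "j = 2 * b" by blast
      with range[OF j(2)] obtain l where "b = Suc l" by (cases b) auto
      with b that show thesis by simp
    qed
    \<comment> \<open>The triple is 2l+1, 2l+2, 2l+3, whose last two are swapped. Its first is
      fixed: a swap with 2l contradicts minimality, and 2l+2 is already taken.\<close>
    have "\<rho> (2*l + 1) \<noteq> 2*l" using min[of "2*l"] down[of "2*l"] l by auto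
    moreover have "\<rho> (2*l + 1) \<noteq> 2*l + 2" using up[of j] up[of "2*l+1"] j l by auto
    ultimately have "\<rho> (2*l + 1) = 2*l + 1" using near[of "2*l+1"] by linarith
    then have "q (2*l + 1) = p (2*l + 1)" "q (2*l + 2) = p (2*l + 3)" "q (2*l + 3) = p (2*l + 2)"
      using q[of "2*l + 1"] q[of "2*l + 2"] q[of "2*l + 3"] j up[OF j(2)] l
      by (auto simp: eval_nat_numeral)
    \<comment> \<open>Swapping two neighbours in the triple negates their own comparison and
      exchanges the other two, so the exclusive or of all three flips.\<close>
    then have "orientation q (Suc l) \<noteq> orientation p (Suc l)"
      using neq[of "2*l+1" "2*l+2"] neq[of "2*l+1" "2*l+3"] neq[of "2*l+2" "2*l+3"]
      unfolding orientation_def by (auto simp: eval_nat_numeral)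
    moreover have "Suc l \<in> {1..n div 2}" using range[OF j(2)] l by auto
    ultimately show ?thesis by blast
  next
    case False
    have "\<exists>j. \<rho> j = Suc j"
    proof -
      obtain x where "\<rho> x \<noteq> x" using \<open>\<rho> \<noteq> id\<close> by (auto simp: fun_eq_iff)
      then have "\<rho> x = Suc x \<or> Suc (\<rho> x) = x" using near[of x] by linarith
      then show ?thesis using down by metis
    qed
    then obtain j0 where "\<rho> j0 = Suc j0" ..
    moreover have bound: "\<forall>y. \<rho> y = Suc y \<longrightarrow> y \<le> n" using range by fastforce
    ultimately obtain j where j: "\<rho> j = Suc j" and max: "\<And>i. \<rho> i = Suc i \<Longrightarrow> i \<le> j"
      using GreatestI_nat[of "\<lambda>j. \<rho> j = Suc j" j0 n]
        Greatest_le_nat[of "\<lambda>j. \<rho> j = Suc j" _ n] that by blast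
    obtain l where l: "j = 2*l + 1" using False j by (blast elim: oddE)
    \<comment> \<open>Now the first two of the triple are swapped. Its last, 2l+3, is fixed: 2l+2 is
      taken, and a swap with 2l+4 contradicts maximality.\<close>
    have "\<rho> (2*l + 3) \<noteq> 2*l + 2" using up[OF j] down[of "2*l+2"] l by (auto simp: eval_nat_numeral)
    moreover have "\<rho> (2*l + 3) \<noteq> 2*l + 4" using max[of "2*l+3"] l by auto
    ultimately have "\<rho> (2*l + 3) = 2*l + 3" using near[of "2*l+3"] by linarith
    then have "q (2*l + 3) = p (2*l + 3)" "q (2*l + 1) = p (2*l + 2)" "q (2*l + 2) = p (2*l + 1)"
      using q[of "2*l + 1"] q[of "2*l + 2"] q[of "2*l + 3"] j up[OF j] l
      by (auto simp: eval_nat_numeral)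
    then have "orientation q (Suc l) \<noteq> orientation p (Suc l)"
      using neq[of "2*l+1" "2*l+2"] neq[of "2*l+1" "2*l+3"] neq[of "2*l+2" "2*l+3"]
      unfolding orientation_def by (auto simp: eval_nat_numeral)
    moreover have "Suc l \<in> {1..n div 2}" using range[OF j] l by auto
    ultimately show ?thesis by blast
  qed
qed

lemma same_colour_G_different:
  assumes \<pi>: "\<pi> permutes {1..n}" and \<sigma>: "\<sigma> permutes {1..n}"
    and "\<pi> \<noteq> \<sigma>" "colour n \<pi> = colour n \<sigma>"
  shows "G_different ({1..} - {1}) n \<pi> \<sigma>"
proof (rule ccontr)
  assume "\<not> ?thesis"
  then have close: "\<bar>int (\<pi> i) - int (\<sigma> i)\<bar> < 2" if "i \<in> {1..n}" for i
    using that unfolding G_different_iff by (auto simp: not_le)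
  have close': "\<bar>int (\<pi> i) - int (\<sigma> i)\<bar> < 2" for i
    using close \<pi> \<sigma> by (cases "i \<in> {1..n}") (auto simp: permutes_not_in)
  \<comment> \<open>\<open>\<rho>\<close> carries each value of \<open>\<pi>\<close> to the value of
    \<open>\<sigma>\<close> at the same position, so closeness of the two permutations becomes
    closeness of \<open>\<rho>\<close> to the identity.\<close>
  define \<rho> where "\<rho> = \<sigma> \<circ> inv \<pi>"
  have "\<exists>k\<in>{1..n div 2}. orientation (inv \<sigma>) k \<noteq> orientation (inv \<pi>) k"
  proof (rule near_identity_flips_orientation)
    show "\<rho> permutes {1..n}" unfolding \<rho>_def by (intro permutes_compose permutes_inv \<pi> \<sigma>)
    show "\<bar>int (\<rho> x) - int x\<bar> < 2" for x
      using close'[of "inv \<pi> x"] permutes_inverses(1)[OF \<pi>, of x] by (simp add: \<rho>_def)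
    show "\<rho> \<noteq> id"
    proof
      assume "\<rho> = id"
      then have "\<sigma> x = \<pi> x" for x
        using fun_cong[of \<rho> id "\<pi> x"] permutes_inverses(2)[OF \<pi>, of x]
        unfolding \<rho>_def comp_apply by simp
      with \<open>\<pi> \<noteq> \<sigma>\<close> show False by auto
    qed
    show "inj (inv \<pi>)" using permutes_inv[OF \<pi>] by (rule permutes_inj)
    show "inv \<sigma> (\<rho> x) = inv \<pi> x" for x
      by (simp add: \<rho>_def permutes_inverses(2)[OF \<sigma>])
  qed
  with \<open>colour n \<pi> = colour n \<sigma>\<close> show False unfolding colour_def by blast
qed

text \<open>Pigeonhole: the colour classes partition the \<open>fact n\<close> permutations, and
  there are \<open>2 ^ (n div 2)\<close> possible colours.\<close>

lemma exists_large_family: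
  "\<exists>F \<in> G_different_families ({1..} - {1}) n. fact n \<le> card F * 2 ^ (n div 2)"
proof -
  let ?S = "{\<pi>. \<pi> permutes {1..n}}" and ?P = "Pow {1..n div 2}"
  let ?F = "\<lambda>A. {\<pi> \<in> ?S. colour n \<pi> = A}"
  have fam: "?F A \<in> G_different_families ({1..} - {1}) n" for A
    unfolding G_different_families_def pairwise_def
    by (blast intro: same_colour_G_different)
  have "\<exists>A\<in>?P. fact n \<le> card (?F A) * 2 ^ (n div 2)"
  proof (rule ccontr)
    assume "\<not> ?thesis"
    then have "\<forall>A\<in>?P. card (?F A) * 2 ^ (n div 2) < fact n" by (auto simp: not_le)
    then have "(\<Sum>A\<in>?P. card (?F A) * 2 ^ (n div 2)) < (\<Sum>A\<in>?P. fact n)"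
      by (intro sum_strict_mono) auto
    also have "\<dots> = fact n * 2 ^ (n div 2)" by (simp add: card_Pow)
    finally have "(\<Sum>A\<in>?P. card (?F A)) < fact n" by (simp add: sum_distrib_right[symmetric])
    moreover have "(\<Sum>A\<in>?P. card (?F A)) = card (\<Union>A\<in>?P. ?F A)"
    proof (rule card_UN_disjoint[symmetric])
      show "\<forall>A\<in>?P. finite (?F A)" by (simp add: finite_permutations)
    qed (simp, blast)
    moreover have "(\<Union>A\<in>?P. ?F A) = ?S"
    proof (intro equalityI subsetI)
      fix \<pi> assume "\<pi> \<in> ?S"
      then have "\<pi> \<in> ?F (colour n \<pi>)" by simp
      moreover have "colour n \<pi> \<in> ?P" by (auto simp: colour_def)
      ultimately show "\<pi> \<in> (\<Union>A\<in>?P. ?F A)" by (rule UN_I[rotated])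
    qed (elim UN_E, simp)
    moreover have "card ?S = fact n" by (rule card_permutations) auto
    ultimately show False by simp
  qed
  with fam show ?thesis by blast
qed

theorem theorem1:
  fixes n :: nat
  assumes "n \<ge> 1"
  shows "real (T n ({1..} - {1})) = fact n / 2 ^ (n div 2)"
proof -
  let ?C = "card ` G_different_families ({1..} - {1}) n"
  have fin: "finite ?C" by (simp add: finite_G_different_families)
  have "T n ({1..} - {1}) \<in> ?C"
    unfolding T_def using fin G_different_families_nonempty by (intro Max_in) auto
  then have "T n ({1..} - {1}) * 2 ^ (n div 2) \<le> fact n"
    using card_family_upper by auto
  moreover obtain F where "F \<in> G_different_families ({1..} - {1}) n"
    and F: "fact n \<le> card F * 2 ^ (n div 2)"
    using exists_large_family by blast
  then have "card F \<le> T n ({1..} - {1})" unfolding T_def using fin by (intro Max_ge) auto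
  with F have "fact n \<le> T n ({1..} - {1}) * 2 ^ (n div 2)"
    by (meson le_trans mult_le_mono1)
  ultimately have "T n ({1..} - {1}) * 2 ^ (n div 2) = fact n" by (rule antisym)
  then have "real (T n ({1..} - {1})) * 2 ^ (n div 2) = fact n"
    by (metis of_nat_fact of_nat_mult of_nat_numeral of_nat_power)
  then show ?thesis by (simp add: field_simps)
qed

end
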